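(* Let $\alpha \in \mathbb{R}_{>0}$, and let $\mathbb{N}_0[\alpha] = \{f(\alpha) \mid f \in \mathbb{N}_0[x]\}$. Then the following statements hold. (1) If $\alpha$ is transcendental, then the semiring $\mathbb{N}_0[\alpha]$ is bi-atomic. (2) If $\alpha$ is algebraic and $\alpha \ge 1$, then the semiring $\mathbb{N}_0[\alpha]$ is bi-atomic.
   Context: $\mathbb{N}_0$ denotes the set of nonnegative integers. A monoid is a cancellative commutative semigroup with identity. An atom of a monoid $M$ is a non-invertible element that cannot be written as a product (sum, in additive notation) of two non-invertible elements of $M$. A monoid is atomic if every non-invertible element is a finite product (sum) of atoms. A positive semiring is a subset $S \subseteq \mathbb{R}_{\ge 0}$ containing $0$ and $1$ and closed under the usual addition and multiplication; its additive monoid is $(S,+)$ and its multiplicative monoid is $(S^\bullet,\cdot)$ with $S^\bullet = S \setminus \{0\}$. The semiring $S$ is bi-atomic if both $(S,+)$ and $(S^\bullet,\cdot)$ are atomic. "Transcendental" and "algebraic" mean over $\mathbb{Q}$. *)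

theory Defs
  imports
    "HOL-Algebra.Divisibility"
    "HOL-Computational_Algebra.Polynomial"
begin

definition monoid_atom :: "('a, 'b) monoid_scheme \<Rightarrow> 'a \<Rightarrow> bool" where
  "monoid_atom M a \<longleftrightarrow>
     a \<in> carrier M \<and> a \<notin> Units M \<and>
     \<not> (\<exists>b \<in> carrier M - Units M. \<exists>c \<in> carrier M - Units M. a = b \<otimes>\<^bsub>M\<^esub> c)"

definition atomic_monoid :: "('a, 'b) monoid_scheme \<Rightarrow> bool" where
  "atomic_monoid M \<longleftrightarrow>
     comm_monoid_cancel M \<and>
     (\<forall>x \<in> carrier M - Units M.
        \<exists>as. (\<forall>a \<in> set as. monoid_atom M a) \<and> foldr (\<otimes>\<^bsub>M\<^esub>) as \<one>\<^bsub>M\<^esub> = x)"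

definition positive_semiring :: "real set \<Rightarrow> bool" where
  "positive_semiring S \<longleftrightarrow>
     S \<subseteq> {0..} \<and> 0 \<in> S \<and> 1 \<in> S \<and>
     (\<forall>x \<in> S. \<forall>y \<in> S. x + y \<in> S) \<and> (\<forall>x \<in> S. \<forall>y \<in> S. x * y \<in> S)"

definition additive_monoid :: "real set \<Rightarrow> real monoid" where
  "additive_monoid S = \<lparr>carrier = S, monoid.mult = (+), one = 0\<rparr>"

definition multiplicative_monoid :: "real set \<Rightarrow> real monoid" where
  "multiplicative_monoid S = \<lparr>carrier = S - {0}, monoid.mult = (*), one = 1\<rparr>"

definition bi_atomic :: "real set \<Rightarrow> bool" where
  "bi_atomic S \<longleftrightarrow>
     positive_semiring S \<and>
     atomic_monoid (additive_monoid S) \<and> atomic_monoid (multiplicative_monoid S)"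

definition nat_adjoin :: "real \<Rightarrow> real set" where
  "nat_adjoin \<alpha> = {poly (map_poly real f) \<alpha> | f :: nat poly. True}"

end

theory Submission imports Defs Complex_Main begin

text \<open>A cancellative commutative monoid is atomic as soon as some \<open>nat\<close>-valued function strictly
  increases under multiplication by any element other than the identity. If \<open>\<alpha> \<ge> 1\<close>, nonzero
  elements of the semiring are at least 1, and those different from 1 are at least some fixed
  \<open>m > 1\<close>; so \<open>\<lfloor>x\<rfloor>\<close> and \<open>\<lfloor>log m x\<rfloor>\<close> are such functions. If \<open>\<alpha>\<close> is transcendental, every element
  is \<open>f(\<alpha>)\<close> for a unique \<open>f\<close>, and \<open>f(1)\<close> and \<open>deg f + f(1)\<close> are such functions.\<close>

lemma atomic_monoid_of_length:
  fixes len :: "'a \<Rightarrow> nat"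
  assumes M: "comm_monoid_cancel M"
    and len: "\<And>b c. \<lbrakk>b \<in> carrier M; c \<in> carrier M; b \<noteq> \<one>\<^bsub>M\<^esub>; c \<noteq> \<one>\<^bsub>M\<^esub>\<rbrakk> \<Longrightarrow> len b < len (b \<otimes>\<^bsub>M\<^esub> c)"
  shows "atomic_monoid M"
proof -
  interpret comm_monoid_cancel M by (rule M)
  have foldr_append: "foldr (\<otimes>\<^bsub>M\<^esub>) (as @ bs) \<one>\<^bsub>M\<^esub> =
      foldr (\<otimes>\<^bsub>M\<^esub>) as \<one>\<^bsub>M\<^esub> \<otimes>\<^bsub>M\<^esub> foldr (\<otimes>\<^bsub>M\<^esub>) bs \<one>\<^bsub>M\<^esub>"
    if "set as \<subseteq> carrier M" "set bs \<subseteq> carrier M" for as bs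
    using that by (induction as) (auto simp: m_assoc)
  have atoms: "\<exists>as. (\<forall>a \<in> set as. monoid_atom M a) \<and> foldr (\<otimes>\<^bsub>M\<^esub>) as \<one>\<^bsub>M\<^esub> = x"
    if "x \<in> carrier M - Units M" for x
    using that
  proof (induction "len x" arbitrary: x rule: less_induct)
    case less
    show ?case
    proof (cases "monoid_atom M x")
      case True
      then show ?thesis using less.prems by (intro exI[of _ "[x]"]) auto
    next
      case False
      then obtain b c where b: "b \<in> carrier M - Units M" and c: "c \<in> carrier M - Units M"
        and x: "x = b \<otimes>\<^bsub>M\<^esub> c"
        using less.prems unfolding monoid_atom_def by blast
      have "b \<noteq> \<one>\<^bsub>M\<^esub>" "c \<noteq> \<one>\<^bsub>M\<^esub>" using b c by auto
      \<comment> \<open>The hypothesis on \<open>len\<close> compares a product with its left factor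
        only; applying it to the swapped pair and using commutativity handles
        \<open>c\<close>.\<close>
      then have "len b < len x" "len c < len x"
        using len[of b c] len[of c b] b c x by (auto simp: m_comm)
      then obtain as bs where as: "\<forall>a \<in> set as. monoid_atom M a" "foldr (\<otimes>\<^bsub>M\<^esub>) as \<one>\<^bsub>M\<^esub> = b"
        and bs: "\<forall>a \<in> set bs. monoid_atom M a" "foldr (\<otimes>\<^bsub>M\<^esub>) bs \<one>\<^bsub>M\<^esub> = c"
        using less.hyps b c by meson
      have "set as \<subseteq> carrier M" "set bs \<subseteq> carrier M"
        using as bs by (auto simp: monoid_atom_def)
      then show ?thesis
        using as bs x foldr_append by (intro exI[of _ "as @ bs"]) auto
    qed
  qed
  then show ?thesis using M by (auto simp: atomic_monoid_def)
qed

lemma comm_monoid_cancel_additive_monoid: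
  "positive_semiring S \<Longrightarrow> comm_monoid_cancel (additive_monoid S)"
  by (intro comm_monoid_cancelI comm_monoidI)
     (auto simp: additive_monoid_def positive_semiring_def)

lemma comm_monoid_cancel_multiplicative_monoid:
  "positive_semiring S \<Longrightarrow> comm_monoid_cancel (multiplicative_monoid S)"
  by (intro comm_monoid_cancelI comm_monoidI)
     (auto simp: multiplicative_monoid_def positive_semiring_def)

text \<open>Reduces each half of the theorem to exhibiting two length functions. The excluded
  elements are the additive identity 0 and, in the multiplicative case, the identity 1 together with
  0, which lies outside that monoid.\<close>

lemma bi_atomic_of_lengths:
  fixes len_add len_mult :: "real \<Rightarrow> nat"
  assumes S: "positive_semiring S"
    and add: "\<And>b c. \<lbrakk>b \<in> S; c \<in> S; b \<noteq> 0; c \<noteq> 0\<rbrakk> \<Longrightarrow> len_add b < len_add (b + c)"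
    and mult: "\<And>b c. \<lbrakk>b \<in> S - {0, 1}; c \<in> S - {0, 1}\<rbrakk> \<Longrightarrow> len_mult b < len_mult (b * c)"
  shows "bi_atomic S"
proof -
  have "atomic_monoid (additive_monoid S)"
    by (rule atomic_monoid_of_length[where len = len_add, OF comm_monoid_cancel_additive_monoid[OF S]])
       (use add in \<open>auto simp: additive_monoid_def\<close>)
  moreover have "atomic_monoid (multiplicative_monoid S)"
    by (rule atomic_monoid_of_length[where len = len_mult, OF comm_monoid_cancel_multiplicative_monoid[OF S]])
       (use mult in \<open>auto simp: multiplicative_monoid_def\<close>)
  ultimately show ?thesis using S by (simp add: bi_atomic_def)
qed

lemma map_poly_real_add: "map_poly real (f + g) = map_poly real f + map_poly real g"
  by (rule poly_eqI) (simp add: coeff_map_poly)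

lemma map_poly_real_mult: "map_poly real (f * g) = map_poly real f * map_poly real g"
  by (rule poly_eqI) (simp add: coeff_map_poly coeff_mult)

lemma poly_map_poly_real_nonneg:
  "(x::real) \<ge> 0 \<Longrightarrow> poly (map_poly real f) x \<ge> 0"
  by (induction f) (auto simp: map_poly_pCons)

lemma positive_semiring_nat_adjoin:
  assumes "\<alpha> \<ge> 0"
  shows "positive_semiring (nat_adjoin \<alpha>)"
proof -
  have "0 \<in> nat_adjoin \<alpha>"
    unfolding nat_adjoin_def by (intro CollectI exI[of _ 0]) simp
  moreover have "1 \<in> nat_adjoin \<alpha>"
    unfolding nat_adjoin_def by (intro CollectI exI[of _ 1]) (simp add: map_poly_1)
  moreover have "x + y \<in> nat_adjoin \<alpha>" "x * y \<in> nat_adjoin \<alpha>"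
    if "x \<in> nat_adjoin \<alpha>" "y \<in> nat_adjoin \<alpha>" for x y
    using that unfolding nat_adjoin_def
    by (auto simp flip: poly_add poly_mult map_poly_real_add map_poly_real_mult)
  ultimately show ?thesis
    using poly_map_poly_real_nonneg[OF assms]
    by (auto simp: positive_semiring_def nat_adjoin_def)
qed

text \<open>Induction along Horner's scheme: a value has the form \<open>c + \<alpha> * y\<close>
  with \<open>y\<close> an earlier value. If \<open>y = 0\<close>, it is the natural number
  \<open>c\<close>; otherwise \<open>y \<ge> 1\<close>, and already
  \<open>\<alpha> * y \<ge> 1\<close>.\<close>

lemma nat_adjoin_ge_1:
  assumes "\<alpha> \<ge> 1" "x \<in> nat_adjoin \<alpha>" "x \<noteq> 0"
  shows "x \<ge> 1"
proof -
  have "poly (map_poly real f) \<alpha> = 0 \<or> poly (map_poly real f) \<alpha> \<ge> 1" for f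
  proof (induction f)
    case (pCons c f)
    show ?case
    proof (cases "poly (map_poly real f) \<alpha> = 0")
      case True
      then show ?thesis by (cases c) (auto simp: map_poly_pCons)
    next
      case False
      then have "\<alpha> * poly (map_poly real f) \<alpha> \<ge> 1 * 1"
        using pCons.IH assms(1) by (intro mult_mono) auto
      then show ?thesis by (simp add: map_poly_pCons)
    qed
  qed simp
  then show ?thesis using assms by (auto simp: nat_adjoin_def)
qed

text \<open>Split off the constant term, \<open>x = c + \<alpha> * y\<close>. If
  \<open>y = 0\<close>, then \<open>x\<close> is a natural number other than 0 and 1, so at least 2;
  otherwise \<open>y \<ge> 1\<close> gives \<open>x \<ge> \<alpha>\<close>. Hence the bound
  \<open>min 2 \<alpha>\<close>. It exceeds 1 only for \<open>\<alpha> > 1\<close>, so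
  \<open>\<alpha> = 1\<close>, where all values are natural numbers, is treated separately.\<close>

lemma nat_adjoin_gap_above_1:
  assumes "\<alpha> \<ge> 1"
  obtains m where "m > 1" "\<And>x. x \<in> nat_adjoin \<alpha> - {0, 1} \<Longrightarrow> x \<ge> m"
proof (cases "\<alpha> = 1")
  case True
  have nat: "poly (map_poly real f) 1 \<in> \<nat>" for f
    by (induction f) (auto simp: map_poly_pCons)
  have "x \<ge> 2" if "x \<in> nat_adjoin \<alpha> - {0, 1}" for x
  proof -
    have "x \<in> \<nat>" using that True nat by (auto simp: nat_adjoin_def)
    then show ?thesis using that by (auto elim!: Nats_cases)
  qed
  then show ?thesis by (intro that[of 2]) auto
next
  case False
  have "x \<ge> min 2 \<alpha>" if x: "x \<in> nat_adjoin \<alpha> - {0, 1}" for x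
  proof -
    obtain f where f: "x = poly (map_poly real f) \<alpha>" using x by (auto simp: nat_adjoin_def)
    obtain c g where g: "f = pCons c g" by (cases f)
    define y where "y = poly (map_poly real g) \<alpha>"
    have xy: "x = real c + \<alpha> * y" by (simp add: f g map_poly_pCons y_def)
    show ?thesis
    proof (cases "y = 0")
      case True
      then have "c \<noteq> 0" "c \<noteq> 1" using x xy by auto
      then show ?thesis using True xy by simp
    next
      case False
      then have "y \<ge> 1"
        using nat_adjoin_ge_1[OF assms, of y] by (auto simp: y_def nat_adjoin_def)
      then have "\<alpha> * 1 \<le> \<alpha> * y" using assms by (intro mult_left_mono) auto
      then show ?thesis using xy by simp
    qed
  qed
  then show ?thesis using False assms by (intro that[of "min 2 \<alpha>"]) auto
qed

lemma bi_atomic_nat_adjoin_ge_1: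
  assumes "\<alpha> \<ge> 1"
  shows "bi_atomic (nat_adjoin \<alpha>)"
proof -
  obtain m where m: "m > 1" "\<And>x. x \<in> nat_adjoin \<alpha> - {0, 1} \<Longrightarrow> x \<ge> m"
    using nat_adjoin_gap_above_1[OF assms] by blast
  show ?thesis
  proof (rule bi_atomic_of_lengths)
    show "positive_semiring (nat_adjoin \<alpha>)"
      using assms by (intro positive_semiring_nat_adjoin) auto
  next
    fix b c assume "b \<in> nat_adjoin \<alpha>" "c \<in> nat_adjoin \<alpha>" "b \<noteq> 0" "c \<noteq> 0"
    then have "b \<ge> 1" "c \<ge> 1" using nat_adjoin_ge_1[OF assms] by auto
    \<comment> \<open>Adding \<open>c \<ge> 1\<close> raises the floor by at least 1, and
      \<open>b \<ge> 1\<close> ensures that \<open>nat\<close> truncates nothing.\<close>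
    then show "nat \<lfloor>b\<rfloor> < nat \<lfloor>b + c\<rfloor>" by linarith
  next
    fix b c assume "b \<in> nat_adjoin \<alpha> - {0, 1}" "c \<in> nat_adjoin \<alpha> - {0, 1}"
    then have bc: "b \<ge> m" "c \<ge> m" using m by auto
    \<comment> \<open>With the gap \<open>m\<close> as base, each factor other than 1 contributes at
      least 1 to the logarithm, so the floor grows as in the additive case.\<close>
    then have "log m b \<ge> 1" "log m c \<ge> 1" using m(1) by auto
    moreover have "log m (b * c) = log m b + log m c"
      using bc m(1) by (subst log_mult) auto
    ultimately show "nat \<lfloor>log m b\<rfloor> < nat \<lfloor>log m (b * c)\<rfloor>" by linarith
  qed
qed

text \<open>The difference of two polynomials with the same value at \<alpha> has integer
  coefficients and the root \<alpha>, so transcendence forces it to be zero.\<close>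

lemma inj_poly_map_poly_real_transcendental:
  assumes "\<not> algebraic (\<alpha>::real)"
  shows "inj (\<lambda>f. poly (map_poly real f) \<alpha>)"
proof (rule injI)
  fix f g assume eq: "poly (map_poly real f) \<alpha> = poly (map_poly real g) \<alpha>"
  \<comment> \<open>The difference is formed over the reals because subtraction on
    \<open>nat\<close> truncates.\<close>
  let ?p = "map_poly real f - map_poly real g"
  have "\<forall>i. coeff ?p i \<in> \<int>" by (simp add: coeff_map_poly)
  moreover have "poly ?p \<alpha> = 0" using eq by simp
  ultimately have "?p = 0" using assms unfolding algebraic_def by blast
  then have "coeff (map_poly real f) i = coeff (map_poly real g) i" for i by simp
  then show "f = g" by (intro poly_eqI) (simp add: coeff_map_poly)
qed

lemma poly_1_nat_pos:
  fixes f :: "nat poly"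
  shows "f \<noteq> 0 \<Longrightarrow> poly f 1 > 0"
  by (induction f) auto

text \<open>The two summands complement each other: a constant factor \<open>c \<ge> 2\<close>
  leaves the degree alone but multiplies the value at 1, while a factor of positive degree raises
  the degree and, its value at 1 being at least 1, does not lower the other summand.\<close>

lemma degree_plus_poly_1_less_mult:
  fixes f g :: "nat poly"
  assumes "f \<noteq> 0" "g \<noteq> 0" "g \<noteq> 1"
  shows "degree f + poly f 1 < degree (f * g) + poly (f * g) 1"
proof (cases "degree g = 0")
  case True
  then obtain c where c: "g = [:c:]" by (metis degree_eq_zeroE)
  then have "c \<ge> 2" using assms by (cases c) (auto simp: one_pCons)
  then have "poly f 1 * 1 < poly f 1 * c" using poly_1_nat_pos[OF assms(1)] by simp
  then show ?thesis using c assms by (simp add: degree_mult_eq)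
next
  case False
  have "poly f 1 * 1 \<le> poly f 1 * poly g 1"
    using poly_1_nat_pos[OF assms(2)] by (intro mult_le_mono) auto
  then show ?thesis
    using False unfolding poly_mult degree_mult_eq[OF assms(1,2)] by linarith
qed

lemma bi_atomic_nat_adjoin_transcendental:
  assumes "\<alpha> > 0" "\<not> algebraic \<alpha>"
  shows "bi_atomic (nat_adjoin \<alpha>)"
proof -
  define ev where "ev f = poly (map_poly real f) \<alpha>" for f
  \<comment> \<open>The length functions must be defined on real numbers; \<open>rep\<close>
    recovers the unique polynomial behind an element, so that lengths of polynomials can be
    transported.\<close>
  define rep where "rep = the_inv ev"
  have "inj ev"
    using inj_poly_map_poly_real_transcendental[OF assms(2)] by (simp add: ev_def[abs_def])
  then have rep: "rep (ev f) = f" for f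
    unfolding rep_def by (rule the_inv_f_f)
  have ev: "ev f + ev g = ev (f + g)" "ev f * ev g = ev (f * g)" "ev 0 = 0" "ev 1 = 1" for f g
    by (simp_all add: ev_def map_poly_real_add map_poly_real_mult map_poly_1)
  have adjoin: "nat_adjoin \<alpha> = range ev" by (auto simp: nat_adjoin_def ev_def)
  show ?thesis
  proof (rule bi_atomic_of_lengths)
    show "positive_semiring (nat_adjoin \<alpha>)"
      using assms by (intro positive_semiring_nat_adjoin) auto
  next
    fix b c assume "b \<in> nat_adjoin \<alpha>" "c \<in> nat_adjoin \<alpha>" "b \<noteq> 0" "c \<noteq> 0"
    then obtain f g where "b = ev f" "c = ev g" "g \<noteq> 0"
      using adjoin ev(3) by auto
    then show "poly (rep b) 1 < poly (rep (b + c)) 1"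
      using poly_1_nat_pos by (simp add: ev rep)
  next
    fix b c assume "b \<in> nat_adjoin \<alpha> - {0, 1}" "c \<in> nat_adjoin \<alpha> - {0, 1}"
    then obtain f g where "b = ev f" "c = ev g" "f \<noteq> 0" "g \<noteq> 0" "g \<noteq> 1"
      using adjoin ev(3,4) by auto
    then show "degree (rep b) + poly (rep b) 1 < degree (rep (b * c)) + poly (rep (b * c)) 1"
      \<comment> \<open>Deleting \<open>poly_mult\<close> keeps \<open>poly (f * g) 1\<close>
        intact, so that the goal matches the lemma.\<close>
      using degree_plus_poly_1_less_mult by (simp add: ev rep del: poly_mult)
  qed
qed

theorem proposition3p7:
  fixes \<alpha> :: real
  assumes "\<alpha> > 0"
  shows "(\<not> algebraic \<alpha> \<longrightarrow> bi_atomic (nat_adjoin \<alpha>)) \<and>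
         (algebraic \<alpha> \<and> \<alpha> \<ge> 1 \<longrightarrow> bi_atomic (nat_adjoin \<alpha>))"
  using assms bi_atomic_nat_adjoin_transcendental bi_atomic_nat_adjoin_ge_1 by blast

end
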